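(* Let $k=1$ or $k=2$, $a>0$, $c>0$ and $\sigma\leq\mu<0$. Let $M_0=-\frac ac$, $N_0=\frac{a\sigma}{c\mu}$, and let $\varphi$ be continuous on $[-\tau,0]$ with $\varphi(t)\geq M_0$ for $t\in[-\tau,0]$, where $\tau=a+c\max\{\varphi(0),N_0\}$. Suppose that the only pair $(M,N)\in[M_0,0]\times[0,N_0]$ satisfying $$\mathcal{J}_{(k)}(N,M,N)=\mathcal{J}_{(k)}(M,N,M)=0$$ is $M=N=0$, where $\mathcal{J}_{(k)}$ is the function defined in the context. Then any solution $u(t)$ of $$\dot u(t)=\mu u(t)+\sigma u(t-a-cu(t)),\quad t>0,\qquad u(t)=\varphi(t),\quad t\leq 0,$$ satisfies $u(t)\to0$ as $t\to\infty$.
   Context: The initial function is $\varphi:(-\infty,0]\to\mathbb{R}$. A solution of the state-dependent delay differential equation is a function $u:\mathbb{R}\to\mathbb{R}$ with $u(t)=\varphi(t)$ for $t\leq0$, whose restriction to $[0,\infty)$ is $C^1$, and which satisfies the differential equation for all $t>0$. For reals $x,y$ put $$D(x,y)=(|\mu|+|\sigma|)\bigl[1+(|\mu|+|\sigma|)\max(|x|,|y|)\,c\bigr]\max(|x|,|y|).$$ For $\theta\leq0$ define $$H_{(1)}(v,x,y)(\theta)=\begin{cases}x,&\theta<0,\\-\frac{\mu}{\sigma}v,&\theta=0,\end{cases}$$ and, for $(x,y)\neq(0,0)$, $$H_{(2)}(v,x,y)(\theta)=\begin{cases}x,&\theta\leq \operatorname{sign}(y-x)\dfrac{x+\mu v/\sigma}{D(x,y)},\\[2mm]-\frac{\mu}{\sigma}v+\operatorname{sign}(y-x)D(x,y)\,\theta,&\theta>\operatorname{sign}(y-x)\dfrac{x+\mu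 v/\sigma}{D(x,y)},\end{cases}$$ with $\operatorname{sign}(0)=0$. For $v\geq M_0$ (i.e. $a+cv\geq0$) and $k\in\{1,2\}$ let $$\mathcal{J}_{(k)}(v,x,y)=v+\frac{\mu}{\sigma}v\,e^{\mu(a+cv)}-\sigma\int_{-a-cv}^{0}e^{-\mu\theta}H_{(k)}(v,x,y)(\theta)\,d\theta,$$ with the convention $\mathcal{J}_{(2)}(0,0,0)=0$.
   Formalization: Continuity of φ on [-τ,0] is taken as continuity at each point of [-τ,0] as a function on (-∞,0], so also from the left at -τ; if only the restriction to [-τ,0] is continuous, values of φ below -τ can be chosen so that a solution tends to infinity. *)

theory Defs
  imports "HOL-Analysis.Analysis"
begin

text \<open>
  A solution is \<open>C\<^sup>1\<close> on \<open>[0,\<infinity>)\<close> with a one-sided derivative at \<open>0\<close>; the equation itself is only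
  required for \<open>t > 0\<close>. Only the values of \<open>\<phi>\<close> on \<open>(-\<infinity>,0]\<close> matter.
\<close>

definition sdde_solution ::
  "real \<Rightarrow> real \<Rightarrow> real \<Rightarrow> real \<Rightarrow> (real \<Rightarrow> real) \<Rightarrow> (real \<Rightarrow> real) \<Rightarrow> bool" where
  "sdde_solution \<mu> \<sigma> a c \<phi> u \<longleftrightarrow>
     (\<forall>t\<le>0. u t = \<phi> t) \<and>
     (\<exists>u'. continuous_on {0..} u' \<and>
           (\<forall>t\<ge>0. (u has_real_derivative u' t) (at t within {0..}))) \<and>
     (\<forall>t>0. (u has_real_derivative \<mu> * u t + \<sigma> * u (t - a - c * u t)) (at t))"

definition D :: "real \<Rightarrow> real \<Rightarrow> real \<Rightarrow> real \<Rightarrow> real \<Rightarrow> real" where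
  "D \<mu> \<sigma> c x y =
     (\<bar>\<mu>\<bar> + \<bar>\<sigma>\<bar>) * (1 + (\<bar>\<mu>\<bar> + \<bar>\<sigma>\<bar>) * max \<bar>x\<bar> \<bar>y\<bar> * c) * max \<bar>x\<bar> \<bar>y\<bar>"

definition H1 :: "real \<Rightarrow> real \<Rightarrow> real \<Rightarrow> real \<Rightarrow> real \<Rightarrow> real \<Rightarrow> real" where
  "H1 \<mu> \<sigma> v x y \<theta> = (if \<theta> < 0 then x else - (\<mu> / \<sigma>) * v)"

text \<open>
  \<open>H2\<close> is meaningful for \<open>(x, y) \<noteq> (0, 0)\<close> and \<open>\<theta> \<le> 0\<close> only: for \<open>x = y = 0\<close> the quotient below has
  denominator \<open>0\<close>.
\<close>

definition H2 :: "real \<Rightarrow> real \<Rightarrow> real \<Rightarrow> real \<Rightarrow> real \<Rightarrow> real \<Rightarrow> real \<Rightarrow> real" where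
  "H2 \<mu> \<sigma> c v x y \<theta> =
     (if \<theta> \<le> sgn (y - x) * ((x + \<mu> * v / \<sigma>) / D \<mu> \<sigma> c x y) then x
      else - (\<mu> / \<sigma>) * v + sgn (y - x) * D \<mu> \<sigma> c x y * \<theta>)"

text \<open>
  \<open>J\<close> is intended for \<open>k \<in> {1, 2}\<close> and \<open>a + c * v \<ge> 0\<close>. The first branch is the convention for
  \<open>k = 2\<close> at the origin.
\<close>

definition J ::
  "real \<Rightarrow> real \<Rightarrow> real \<Rightarrow> real \<Rightarrow> nat \<Rightarrow> real \<Rightarrow> real \<Rightarrow> real \<Rightarrow> real" where
  "J \<mu> \<sigma> a c k v x y =
     (if k = 2 \<and> v = 0 \<and> x = 0 \<and> y = 0 then 0
      else v + \<mu> / \<sigma> * v * exp (\<mu> * (a + c * v))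
           - \<sigma> * integral {- a - c * v..0}
               (\<lambda>\<theta>. exp (- \<mu> * \<theta>) *
                    (if k = 1 then H1 \<mu> \<sigma> v x y \<theta> else H2 \<mu> \<sigma> c v x y \<theta>)))"

end

theory Submission
  imports Defs
begin

text \<open>
  Let \<open>M\<close> and \<open>N\<close> be the lower and upper limits of \<open>u\<close> at infinity. The solution stays in
  \<open>[M0, max (\<phi> 0) N0]\<close> (\<open>sdde_bounds\<close>), so both are finite and the delay \<open>a + c u\<close> is nonnegative
  and bounded.

  At times \<open>t\<close> with \<open>u t\<close> close to \<open>N\<close> the derivative is small, because it is Lipschitz and \<open>u\<close>
  cannot exceed \<open>N\<close> by much. By the equation the delayed value \<open>\<eta> t = u (t - a - c u t)\<close> is then close
  to \<open>-\<mu> N / \<sigma>\<close>. On the whole delay interval \<open>\<eta>\<close> is almost bounded below by \<open>M\<close> and is Lipschitz with a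
  constant close to \<open>D M N\<close>; \<open>H1\<close> encodes the first of these bounds and \<open>H2\<close> both. Since
  \<open>\<sigma> < 0\<close>, variation of constants over \<open>[t - a - c u t, t]\<close> turns a lower bound on \<open>\<eta>\<close> into an upper
  bound on \<open>u t\<close>, and in the limit \<open>J (N, M, N) \<le> 0\<close>. The function \<open>-u\<close> solves the same
  equation with \<open>-c\<close> in place of \<open>c\<close>, and the same argument gives \<open>J (M, N, M) \<ge> 0\<close>
  (\<open>limsup_inequalities\<close>, which therefore allows either sign of \<open>c\<close>).

  It remains to pass from these inequalities to equations (\<open>no_nonzero_subsolution\<close>). The pairs in
  \<open>[M0, 0] \<times> [0, N0]\<close> satisfying both inequalities form a compact set, on which \<open>N - M\<close> has a
  maximum. If one of the inequalities were strict there, the corresponding end point could be moved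
  outwards, since the other inequality survives by monotonicity and the boundary values \<open>N0\<close> and \<open>M0\<close>
  violate the inequalities. So at the maximum both are equations, the maximum is \<open>0\<close> by
  hypothesis, and \<open>M = N = 0\<close> for every pair satisfying the inequalities.
\<close>

section \<open>The variation-of-constants defect\<close>

text \<open>
  The best lower bound at \<open>\<theta> \<le> 0\<close> for a function that is at least \<open>x\<close>, and, for \<open>k \<noteq> 1\<close>, also takes
  the value \<open>h\<close> at \<open>0\<close> and is Lipschitz with constant \<open>d\<close>.
\<close>

definition envelope :: "nat \<Rightarrow> real \<Rightarrow> real \<Rightarrow> real \<Rightarrow> real \<Rightarrow> real" where
  "envelope k x h d \<theta> = (if k = 1 then x else max x (h + d * \<theta>))"

text \<open>
  If \<open>w' = \<mu> w + \<sigma> \<eta>\<close> on an interval of length \<open>r\<close> with left end value \<open>h\<close> and right end value \<open>v\<close>,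
  then \<open>v - h exp (\<mu> r)\<close> is \<open>\<sigma>\<close> times the integral of \<open>exp (-\<mu> \<theta>) \<eta> (\<theta>)\<close> over \<open>[-r, 0]\<close>, with
  time counted from the right end. The defect is the amount by which this identity fails when \<open>\<eta>\<close>
  is replaced by its lower bound. Writing \<open>\<theta> = -r s\<close> makes the domain of integration independent of
  \<open>r\<close>, so that the defect is visibly jointly continuous.
\<close>

definition defect :: "real \<Rightarrow> real \<Rightarrow> nat \<Rightarrow> real \<Rightarrow> real \<Rightarrow> real \<Rightarrow> real \<Rightarrow> real \<Rightarrow> real" where
  "defect \<mu> \<sigma> k r v h x d =
     v - h * exp (\<mu> * r) - \<sigma> * (r * integral {0..1} (\<lambda>s. exp (\<mu> * (r * s)) * envelope k x h d (- (r * s))))"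

lemma envelope_integrable:
  "(\<lambda>s. exp (\<mu> * (r * s)) * envelope k x h d (- (r * s))) integrable_on {0..1}"
  unfolding envelope_def
  by (cases "k = 1") (auto intro!: integrable_continuous_real continuous_intros)

lemma continuous_on_defect: "continuous_on UNIV (\<lambda>(r, v, h, x, d). defect \<mu> \<sigma> k r v h x d)"
proof -
  have "continuous_on (UNIV \<times> cbox 0 1)
     (\<lambda>((r, v, h, x, d), s::real). exp (\<mu> * (r * s)) * envelope k x h d (- (r * s)))"
    unfolding envelope_def case_prod_unfold
    by (cases "k = 1") (auto intro!: continuous_intros)
  from integral_continuous_on_param[where f = "\<lambda>(r, v, h, x, d) s. exp (\<mu> * (r * s)) * envelope k x h d (- (r * s))" and U = UNIV and a = 0 and b = 1]
  have *: "continuous_on UNIV (\<lambda>(r, v::real, h, x, d). integral {0..1} (\<lambda>s. exp (\<mu> * (r * s)) * envelope k x h d (- (r * s))))"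
    using \<open>continuous_on _ _\<close> by (simp add: case_prod_unfold)
  show ?thesis
    using * unfolding defect_def case_prod_unfold
    by (intro continuous_intros)
qed

lemma tendsto_defect:
  assumes "(r \<longlongrightarrow> r0) F" "(v \<longlongrightarrow> v0) F" "(h \<longlongrightarrow> h0) F" "(x \<longlongrightarrow> x0) F" "(d \<longlongrightarrow> d0) F"
  shows "((\<lambda>t. defect \<mu> \<sigma> k (r t) (v t) (h t) (x t) (d t)) \<longlongrightarrow> defect \<mu> \<sigma> k r0 v0 h0 x0 d0) F"
proof -
  have "isCont (\<lambda>(r, v, h, x, d). defect \<mu> \<sigma> k r v h x d) (r0, v0, h0, x0, d0)"
    using continuous_on_defect by (simp add: continuous_on_eq_continuous_at)
  from isCont_tendsto_compose[OF this, of "\<lambda>t. (r t, v t, h t, x t, d t)" F]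
  show ?thesis using assms by (simp add: tendsto_Pair)
qed

text \<open>
  Since \<open>-\<sigma> r \<ge> 0\<close>, the defect inherits the monotonicity of the lower bound.
\<close>

lemma defect_mono:
  assumes "\<sigma> \<le> 0" "0 \<le> r" "x \<le> x'" "d' \<le> d"
  shows "defect \<mu> \<sigma> k r v h x d \<le> defect \<mu> \<sigma> k r v h x' d'"
proof -
  have "envelope k x h d (- (r * s)) \<le> envelope k x' h d' (- (r * s))" if "0 \<le> s" for s
    using assms mult_right_mono[of d' d "r * s"] that by (auto simp: envelope_def max_def)
  then have "integral {0..1} (\<lambda>s. exp (\<mu> * (r * s)) * envelope k x h d (- (r * s)))
     \<le> integral {0..1} (\<lambda>s. exp (\<mu> * (r * s)) * envelope k x' h d' (- (r * s)))"
    by (intro integral_le envelope_integrable) auto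
  from mult_left_mono_neg[OF mult_left_mono[OF this \<open>0 \<le> r\<close>] \<open>\<sigma> \<le> 0\<close>]
  show ?thesis unfolding defect_def by simp
qed

lemma substitution_unit_interval:
  fixes f :: "real \<Rightarrow> real"
  assumes "0 \<le> r" and f: "continuous_on {-r..0} f"
  shows "integral {- r..0} f = r * integral {0..1} (\<lambda>s. f (- (r * s)))"
proof (cases "r = 0")
  case False
  then have r: "r > 0" using assms by simp
  have "(f has_integral integral {-r..0} f) (cbox (-r) 0)"
    using f by (simp add: integrable_continuous_real integrable_integral)
  from has_integral_affinity[OF this, of "-r" 0]
  have "((\<lambda>s. f (- (r * s))) has_integral integral {-r..0} f / r) ((\<lambda>x. - (x / r)) ` {-r..0})"
    using r by (simp add: divide_inverse mult.commute)
  moreover have "(\<lambda>x. - (x / r)) ` {-r..0} = {0..1}"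
  proof -
    have "y \<in> (\<lambda>x. - (x / r)) ` {-r..0}" if "y \<in> {0..1}" for y
      by (rule image_eqI[of _ _ "- r * y"]) (use that r in \<open>auto simp: mult_le_cancel_left1\<close>)
    then show ?thesis using r by (auto simp: field_simps)
  qed
  ultimately show ?thesis using r by (simp add: integral_unique)
qed simp

text \<open>
  For every \<open>k\<close> the lower bound is at least its first part \<open>x\<close>, for which the integral is elementary.
\<close>

lemma defect_ge:
  assumes "\<mu> \<noteq> 0" "\<sigma> \<le> 0" "0 \<le> r"
  shows "v - h * exp (\<mu> * r) - \<sigma> * x * ((exp (\<mu> * r) - 1) / \<mu>) \<le> defect \<mu> \<sigma> k r v h x d"
proof -
  have "((\<lambda>s. r * exp (\<mu> * (r * s))) has_integral exp (\<mu> * (r * 1)) / \<mu> - exp (\<mu> * (r * 0)) / \<mu>) {0..1}"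
    by (rule fundamental_theorem_of_calculus)
       (auto simp flip: has_real_derivative_iff_has_vector_derivative
             intro!: derivative_eq_intros simp: assms)
  then have I: "((\<lambda>s. x * (r * exp (\<mu> * (r * s)))) has_integral x * ((exp (\<mu> * r) - 1) / \<mu>)) {0..1}"
    by (intro has_integral_mult_right) (simp add: diff_divide_distrib)
  have "((\<lambda>s. r * (exp (\<mu> * (r * s)) * envelope k x h d (- (r * s)))) has_integral
      r * integral {0..1} (\<lambda>s. exp (\<mu> * (r * s)) * envelope k x h d (- (r * s)))) {0..1}"
    by (intro has_integral_mult_right integrable_integral envelope_integrable)
  moreover have "x * (r * exp (\<mu> * (r * s))) \<le> r * (exp (\<mu> * (r * s)) * envelope k x h d (- (r * s)))" for s
  proof -
    have "(r * exp (\<mu> * (r * s))) * x \<le> (r * exp (\<mu> * (r * s))) * envelope k x h d (- (r * s))"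
      using assms by (intro mult_left_mono) (auto simp: envelope_def)
    then show ?thesis by (simp only: mult.assoc mult.commute[of x])
  qed
  ultimately have "x * ((exp (\<mu> * r) - 1) / \<mu>) \<le> r * integral {0..1} (\<lambda>s. exp (\<mu> * (r * s)) * envelope k x h d (- (r * s)))"
    using has_integral_le[OF I] by blast
  from mult_left_mono_neg[OF this \<open>\<sigma> \<le> 0\<close>] show ?thesis unfolding defect_def by (simp add: mult.assoc)
qed

section \<open>Expressing \<open>J\<close> through the defect\<close>

lemma D_pos:
  assumes "\<mu> < 0" "0 \<le> c" "x \<noteq> y"
  shows "0 < D \<mu> \<sigma> c x y"
proof -
  have "0 < max \<bar>x\<bar> \<bar>y\<bar>" using assms by auto
  moreover have "0 < \<bar>\<mu>\<bar> + \<bar>\<sigma>\<bar>" using assms by auto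
  ultimately show ?thesis unfolding D_def using assms
    by (intro mult_pos_pos add_pos_nonneg mult_nonneg_nonneg) auto
qed

lemma tendsto_D:
  assumes "(x \<longlongrightarrow> x0) F" "(y \<longlongrightarrow> y0) F"
  shows "((\<lambda>t. D \<mu> \<sigma> c (x t) (y t)) \<longlongrightarrow> D \<mu> \<sigma> c x0 y0) F"
proof -
  have "((\<lambda>t. max \<bar>x t\<bar> \<bar>y t\<bar>) \<longlongrightarrow> max \<bar>x0\<bar> \<bar>y0\<bar>) F"
    by (rule tendsto_max tendsto_rabs assms)+
  from tendsto_mult[OF tendsto_mult[OF tendsto_const tendsto_add[OF tendsto_const tendsto_mult[OF tendsto_mult[OF tendsto_const this] tendsto_const]]] this]
  show ?thesis unfolding D_def .
qed

lemma D_mono: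
  assumes "0 \<le> c" "\<bar>x\<bar> \<le> \<bar>x'\<bar>" "\<bar>y\<bar> \<le> \<bar>y'\<bar>"
  shows "D \<mu> \<sigma> c x y \<le> D \<mu> \<sigma> c x' y'"
proof -
  have *: "max \<bar>x\<bar> \<bar>y\<bar> \<le> max \<bar>x'\<bar> \<bar>y'\<bar>" using assms by auto
  show ?thesis unfolding D_def
    by (intro mult_mono add_mono mult_right_mono mult_left_mono *) (use * assms in \<open>auto intro!: mult_nonneg_nonneg add_nonneg_nonneg\<close>)
qed

text \<open>
  After multiplication by \<open>D > 0\<close>, the condition on \<open>\<theta>\<close> in \<open>H2\<close> compares its two branches: they are
  exchanged where they cross, which makes \<open>H2\<close> their maximum if \<open>e = 1\<close> and their minimum if \<open>e = -1\<close>.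
\<close>

lemma H2_eq_max:
  assumes "\<mu> < 0" "0 \<le> c" "x \<noteq> y" and e: "e = sgn (y - x)"
  shows "H2 \<mu> \<sigma> c v x y \<theta> = e * max (e * x) (- (\<mu> / \<sigma>) * (e * v) + D \<mu> \<sigma> c x y * \<theta>)"
proof -
  have D: "0 < D \<mu> \<sigma> c x y" using D_pos assms by simp
  have e1: "e = 1 \<or> e = -1" using assms by (auto simp: sgn_if)
  have "\<theta> \<le> e * ((x + \<mu> * v / \<sigma>) / D \<mu> \<sigma> c x y) \<longleftrightarrow> - (\<mu> / \<sigma>) * (e * v) + D \<mu> \<sigma> c x y * \<theta> \<le> e * x"
    using D e1 by (auto simp: pos_le_divide_eq pos_le_minus_divide_eq algebra_simps)
  then show ?thesis
    unfolding H2_def e[symmetric] using e1 by (auto simp: max_def)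
qed

text \<open>
  The two uses are \<open>(v, x, y) = (N, M, N)\<close> with \<open>e = 1\<close> and \<open>(v, x, y) = (M, N, M)\<close> with \<open>e = -1\<close>,
  for \<open>M < N\<close>; the sign turns the upper bound of the second case into a lower bound.
\<close>

lemma J_eq_defect:
  assumes k: "k = 1 \<or> k = 2" and "\<mu> < 0" "0 \<le> c" and r: "0 \<le> a + c * v"
    and "x \<noteq> y" and e: "e = sgn (y - x)"
  shows "J \<mu> \<sigma> a c k v x y =
    e * defect \<mu> \<sigma> k (a + c * v) (e * v) (- (\<mu> / \<sigma>) * (e * v)) (e * x) (D \<mu> \<sigma> c x y)"
proof -
  have e1: "e = 1 \<or> e = -1" using assms by (auto simp: sgn_if)
  then have ee: "e * (e * z) = z" for z by auto
  define p where "p = envelope k (e * x) (- (\<mu> / \<sigma>) * (e * v)) (D \<mu> \<sigma> c x y)"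
  have p: "continuous_on A p" for A
    unfolding p_def envelope_def by (cases "k = 1") (auto intro!: continuous_intros)
  have "(if k = 1 then H1 \<mu> \<sigma> v x y \<theta> else H2 \<mu> \<sigma> c v x y \<theta>) = e * p \<theta>"
    if "\<theta> < 0" for \<theta>
  proof (cases "k = 1")
    case True
    then show ?thesis using that by (simp add: H1_def p_def envelope_def ee)
  next
    case False
    then show ?thesis using H2_eq_max[OF \<open>\<mu> < 0\<close> \<open>0 \<le> c\<close> \<open>x \<noteq> y\<close> e]
      by (simp add: p_def envelope_def)
  qed
  \<comment> \<open>For \<open>k = 1\<close> the integrands differ at \<open>\<theta> = 0\<close>, a null set.\<close>
  then have "integral {- (a + c * v)..0} (\<lambda>\<theta>. exp (- \<mu> * \<theta>) *
         (if k = 1 then H1 \<mu> \<sigma> v x y \<theta> else H2 \<mu> \<sigma> c v x y \<theta>))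
     = integral {- (a + c * v)..0} (\<lambda>\<theta>. e * (exp (- \<mu> * \<theta>) * p \<theta>))"
    by (intro integral_spike[where S = "{0}"]) (simp_all add: mult.left_commute[of e])
  also have "\<dots> = (a + c * v) * integral {0..1} (\<lambda>s. e * (exp (- \<mu> * - ((a + c * v) * s)) * p (- ((a + c * v) * s))))"
    using r by (intro substitution_unit_interval) (auto intro!: continuous_intros p)
  also have "\<dots> = e * ((a + c * v) * integral {0..1} (\<lambda>s. exp (\<mu> * ((a + c * v) * s)) * p (- ((a + c * v) * s))))"
    by simp
  finally have *: "integral {- a - c * v..0} (\<lambda>\<theta>. exp (- \<mu> * \<theta>) *
         (if k = 1 then H1 \<mu> \<sigma> v x y \<theta> else H2 \<mu> \<sigma> c v x y \<theta>)) =
      e * ((a + c * v) * integral {0..1} (\<lambda>s. exp (\<mu> * ((a + c * v) * s)) * p (- ((a + c * v) * s))))"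
    by (simp only: minus_add_distrib diff_conv_add_uminus)
  show ?thesis unfolding J_def defect_def p_def[symmetric] *
    by (use e1 \<open>x \<noteq> y\<close> in \<open>auto simp: right_diff_distrib algebra_simps\<close>)
qed

section \<open>Real functions near their upper limit\<close>

text \<open>
  If \<open>g t\<close> were larger, \<open>w\<close> would rise above \<open>n\<close> within the time \<open>\<delta>\<close> after \<open>t\<close>, its slope changing by at
  most \<open>K \<delta>\<close>; if it were smaller, \<open>w\<close> would have been above \<open>n\<close> at time \<open>t - \<delta>\<close>.
\<close>

lemma derivative_small_near_supremum:
  fixes w g :: "real \<Rightarrow> real"
  assumes "0 < \<delta>"
    and der: "\<And>s. \<bar>s - t\<bar> \<le> \<delta> \<Longrightarrow> (w has_real_derivative g s) (at s)"
    and lip: "\<And>s. \<bar>s - t\<bar> \<le> \<delta> \<Longrightarrow> \<bar>g s - g t\<bar> \<le> K * \<bar>s - t\<bar>"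
    and "0 \<le> K" "w (t - \<delta>) \<le> n" "w (t + \<delta>) \<le> n" "n - \<delta>\<^sup>2 \<le> w t"
  shows "\<bar>g t\<bar> \<le> (1 + K) * \<delta>"
proof -
  have near: "\<bar>g z - g t\<bar> \<le> K * \<delta>" if "\<bar>z - t\<bar> \<le> \<delta>" for z
    using lip[OF that] mult_left_mono[OF that \<open>0 \<le> K\<close>] by linarith
  obtain z where z: "t < z" "z < t + \<delta>" "w (t + \<delta>) - w t = \<delta> * g z"
    using MVT2[of t "t + \<delta>" w g] der \<open>0 < \<delta>\<close> by auto
  then have "\<delta> * g z \<le> \<delta> * \<delta>" using assms unfolding power2_eq_square by linarith
  then have "g z \<le> \<delta>" using \<open>0 < \<delta>\<close> by simp
  moreover obtain y where y: "t - \<delta> < y" "y < t" "w t - w (t - \<delta>) = \<delta> * g y"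
    using MVT2[of "t - \<delta>" t w g] der \<open>0 < \<delta>\<close> by auto
  then have "\<delta> * (- \<delta>) \<le> \<delta> * g y" using assms unfolding power2_eq_square by linarith
  then have "- \<delta> \<le> g y" using \<open>0 < \<delta>\<close> by (simp only: mult_le_cancel_left_pos)
  ultimately show ?thesis using near[of z] near[of y] z y by (simp add: distrib_right)
qed

lemma limsup_exists:
  fixes w :: "real \<Rightarrow> real"
  assumes "\<forall>\<^sub>F t in at_top. \<bar>w t\<bar> \<le> B"
  obtains N where "\<And>e. e > 0 \<Longrightarrow> \<forall>\<^sub>F t in at_top. w t < N + e"
    and "\<And>e. e > 0 \<Longrightarrow> \<exists>\<^sub>F t in at_top. N - e < w t"
proof -
  define S where "S = {b. \<forall>\<^sub>F t in at_top. w t \<le> b}"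
  have "B \<in> S" unfolding S_def using assms by (auto elim: eventually_mono)
  have low: "- B \<le> b" if "b \<in> S" for b
  proof -
    have "\<forall>\<^sub>F t::real in at_top. - B \<le> b"
      using that[unfolded S_def mem_Collect_eq] assms by eventually_elim auto
    then show ?thesis by simp
  qed
  then have bdd: "bdd_below S" by (auto simp: bdd_below_def)
  show thesis
  proof
    fix e :: real assume "e > 0"
    then obtain b where "b \<in> S" "b < Inf S + e"
      using cInf_lessD[of S "Inf S + e"] \<open>B \<in> S\<close> by auto
    then show "\<forall>\<^sub>F t in at_top. w t < Inf S + e"
      unfolding S_def by (auto elim: eventually_mono)
    show "\<exists>\<^sub>F t in at_top. Inf S - e < w t"
    proof (rule ccontr)
      assume "\<not> ?thesis"
      then have "Inf S - e \<in> S" by (simp add: S_def not_frequently not_less)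
      then show False using cInf_lower[OF _ bdd] \<open>e > 0\<close> by fastforce
    qed
  qed
qed

lemma last_crossing:
  fixes f :: "real \<Rightarrow> real"
  assumes "continuous_on {0..} f" "f 0 \<le> b" "b < f t1" "0 \<le> t1"
  obtains t0 where "0 \<le> t0" "t0 < t1" "f t0 = b" "\<And>t. t0 < t \<Longrightarrow> t \<le> t1 \<Longrightarrow> b < f t"
proof -
  define S where "S = {0..t1} \<inter> f -` {..b}"
  have cont: "continuous_on {0..t1} f" using assms continuous_on_subset by fastforce
  then have "closed S" unfolding S_def
    by (intro continuous_closed_preimage) auto
  moreover have "bounded S" by (rule bounded_subset[of "{0..t1}"]) (auto simp: S_def)
  ultimately have "compact S" by (simp add: compact_eq_bounded_closed)
  moreover have "0 \<in> S" using assms by (simp add: S_def)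
  ultimately obtain t0 where t0: "t0 \<in> S" "\<forall>s\<in>S. s \<le> t0"
    using compact_attains_sup[of S] by blast
  have up: "b < f t" if "t0 < t" "t \<le> t1" for t
    using t0 that by (auto simp: S_def not_le[symmetric] dest!: bspec[of _ _ t])
  have "t0 \<noteq> t1" "t0 \<le> t1" using t0(1) assms by (auto simp: S_def)
  then have "t0 < t1" by simp
  have "b \<le> f t0"
  proof (rule ccontr)
    assume "\<not> ?thesis"
    then obtain x where "t0 \<le> x" "x \<le> t1" "f x = b"
      using IVT'[of f t0 b t1] t0 assms continuous_on_subset[OF cont, of "{t0..t1}"] by (auto simp: S_def)
    then show False using up[of x] \<open>\<not> b \<le> f t0\<close> by (cases "x = t0") auto
  qed
  then show thesis using that[of t0] t0 up \<open>t0 < t1\<close> by (auto simp: S_def)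
qed

section \<open>Inequalities for the upper and lower limits\<close>

text \<open>
  Variation of constants: replacing \<open>\<eta>\<close> by a lower bound increases \<open>\<sigma> \<eta>\<close>, and hence the value
  reached at time \<open>t\<close>.
\<close>

lemma defect_nonpos:
  assumes "\<sigma> \<le> 0" "0 \<le> r"
    and der: "\<And>s. t - r \<le> s \<Longrightarrow> s \<le> t \<Longrightarrow> (w has_real_derivative \<mu> * w s + \<sigma> * \<eta> s) (at s)"
    and low: "\<And>s. t - r \<le> s \<Longrightarrow> s \<le> t \<Longrightarrow> envelope k x (w (t - r)) d (s - t) \<le> \<eta> s"
  shows "defect \<mu> \<sigma> k r (w t) (w (t - r)) x d \<le> 0"
proof -
  define h where "h = w (t - r)"
  define f where "f s = exp (\<mu> * (r * s)) * w (t - r * s)" for s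
  define I where "I = integral {0..1} (\<lambda>s. exp (\<mu> * (r * s)) * envelope k x h d (- (r * s)))"
  have range: "t - r \<le> t - r * s" "t - r * s \<le> t" if "0 \<le> s" "s \<le> 1" for s
    using that \<open>0 \<le> r\<close> mult_left_mono[of s 1 r] by auto
  have "(f has_real_derivative (- \<sigma> * r) * (exp (\<mu> * (r * s)) * \<eta> (t - r * s))) (at s within {0..1})"
    if "0 \<le> s" "s \<le> 1" for s
  proof -
    have [derivative_intros]: "((\<lambda>s. w (t - r * s)) has_real_derivative
        (\<mu> * w (t - r * s) + \<sigma> * \<eta> (t - r * s)) * - r) (at s within {0..1})"
      by (rule DERIV_chain2[where f = w], rule der[OF range[OF that]]) (auto intro!: derivative_eq_intros)
    show ?thesis unfolding f_def
      by (rule derivative_eq_intros refl)+ (simp add: algebra_simps)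
  qed
  then have f: "((\<lambda>s. (- \<sigma> * r) * (exp (\<mu> * (r * s)) * \<eta> (t - r * s))) has_integral f 1 - f 0) {0..1}"
    by (intro fundamental_theorem_of_calculus)
       (auto simp flip: has_real_derivative_iff_has_vector_derivative)
  have "((\<lambda>s. (- \<sigma> * r) * (exp (\<mu> * (r * s)) * envelope k x h d (- (r * s)))) has_integral (- \<sigma> * r) * I) {0..1}"
    unfolding I_def by (intro has_integral_mult_right integrable_integral envelope_integrable)
  then have "(- \<sigma> * r) * I \<le> f 1 - f 0"
  proof (rule has_integral_le[OF _ f])
    fix s :: real assume "s \<in> {0..1}"
    then have "envelope k x h d (- (r * s)) \<le> \<eta> (t - r * s)"
      using low[OF range] by (simp add: h_def)
    then show "(- \<sigma> * r) * (exp (\<mu> * (r * s)) * envelope k x h d (- (r * s)))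
        \<le> (- \<sigma> * r) * (exp (\<mu> * (r * s)) * \<eta> (t - r * s))"
      using assms(1,2) by (intro mult_left_mono) (auto simp: mult_nonpos_nonneg)
  qed
  then show ?thesis unfolding defect_def h_def[symmetric] I_def[symmetric]
    by (simp add: f_def h_def algebra_simps)
qed

text \<open>
  The inequality at a finite time, before passing to the limit: \<open>m\<close> and \<open>n\<close> are strict eventual bounds
  of \<open>w\<close>, and \<open>v\<close> is a value of \<open>w\<close> within \<open>\<delta>\<^sup>2\<close> of \<open>n\<close>, with delayed value \<open>h\<close>. The constant
  \<open>L\<close> bounds \<open>w'\<close>, and \<open>d = L (1 + \<bar>c\<bar> L)\<close> is then a Lipschitz constant of the delayed value, which is
  where \<open>D\<close> comes from.
\<close>

lemma near_sup_point:
  fixes w :: "real \<Rightarrow> real"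
  assumes "\<sigma> \<le> 0"
    and der: "\<And>t. T \<le> t \<Longrightarrow> (w has_real_derivative \<mu> * w t + \<sigma> * w (t - a - c * w t)) (at t)"
    and delay: "\<And>t. T \<le> t \<Longrightarrow> 0 \<le> a + c * w t" "\<And>t. T \<le> t \<Longrightarrow> a + c * w t \<le> R"
    and m: "\<forall>\<^sub>F t in at_top. m < w t" and n: "\<forall>\<^sub>F t in at_top. w t < n"
    and freq: "\<exists>\<^sub>F t in at_top. n - \<delta>\<^sup>2 < w t" and \<delta>: "0 < \<delta>" "\<delta> \<le> 1"
    and L: "L = (\<bar>\<mu>\<bar> + \<bar>\<sigma>\<bar>) * max \<bar>m\<bar> \<bar>n\<bar>" and d: "d = D \<mu> \<sigma> \<bar>c\<bar> m n"
  obtains v h where "n - \<delta>\<^sup>2 < v" "v < n" "m < h" "h < n" "0 \<le> a + c * v"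
    "\<bar>\<mu> * v + \<sigma> * h\<bar> \<le> (1 + (\<bar>\<mu>\<bar> * L + \<bar>\<sigma>\<bar> * d)) * \<delta>"
    "defect \<mu> \<sigma> k (a + c * v) v h m d \<le> 0"
proof -
  define \<eta> where "\<eta> t = w (t - a - c * w t)" for t
  define g where "g t = \<mu> * w t + \<sigma> * \<eta> t" for t
  have dL: "d = L * (1 + \<bar>c\<bar> * L)" unfolding d L D_def by (simp add: algebra_simps)
  have L0: "0 \<le> L" unfolding L by (intro mult_nonneg_nonneg) auto
  have d0: "0 \<le> d" unfolding dL using L0 by auto
  have "0 \<le> R" using delay[of T] by simp
  obtain T1 where T1: "T \<le> T1" "\<And>t. T1 \<le> t \<Longrightarrow> m < w t \<and> w t < n"
  proof -
    have "\<forall>\<^sub>F t in at_top. T \<le> t \<and> m < w t \<and> w t < n"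
      using m n eventually_ge_at_top[of T] by eventually_elim auto
    then show ?thesis using that unfolding eventually_at_top_linorder by blast
  qed
  \<comment> \<open>Each delay costs a time of at most \<open>R\<close>: the bounds on \<open>w\<close> hold from \<open>T1\<close> on, those on its derivative
     from \<open>T2\<close> on, and the Lipschitz bounds on \<open>\<eta>\<close> and on the derivative from \<open>T3\<close> on.\<close>
  define T2 where "T2 = T1 + R"
  define T3 where "T3 = T2 + R"
  have T23: "T \<le> T2" "T1 \<le> T2" "T2 \<le> T3" "T \<le> T3" "T1 \<le> T3" using \<open>0 \<le> R\<close> T1(1) by (auto simp: T2_def T3_def)
  have K: "\<bar>w t\<bar> \<le> max \<bar>m\<bar> \<bar>n\<bar>" if "T1 \<le> t" for t using T1(2)[OF that] by auto
  have \<eta>T1: "T1 \<le> t - a - c * w t" if "T2 \<le> t" for t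
    using delay(2)[of t] that T23 by (auto simp: T2_def)
  have \<eta>T2: "T2 \<le> t - a - c * w t" if "T3 \<le> t" for t
    using delay(2)[of t] that T23 by (auto simp: T3_def)
  have derg: "(w has_real_derivative g t) (at t)" if "T \<le> t" for t
    using der[OF that] by (simp add: g_def \<eta>_def)
  have gL: "\<bar>g t\<bar> \<le> L" if "T2 \<le> t" for t
  proof -
    have "\<bar>\<mu> * w t\<bar> \<le> \<bar>\<mu>\<bar> * max \<bar>m\<bar> \<bar>n\<bar>" "\<bar>\<sigma> * \<eta> t\<bar> \<le> \<bar>\<sigma>\<bar> * max \<bar>m\<bar> \<bar>n\<bar>"
      unfolding abs_mult \<eta>_def using K[of t] K[OF \<eta>T1[OF that]] that T23
      by (auto intro!: mult_left_mono)
    then show ?thesis unfolding L g_def distrib_right by linarith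
  qed
  have wL: "\<bar>w s - w t\<bar> \<le> L * \<bar>s - t\<bar>" if "T2 \<le> s" "T2 \<le> t" for s t
    using field_differentiable_bound[of "{T2..}" w g L s t] derg gL that T23
    by (force intro: has_field_derivative_at_within)
  have \<eta>L: "\<bar>\<eta> s - \<eta> t\<bar> \<le> d * \<bar>s - t\<bar>" if "T3 \<le> s" "T3 \<le> t" for s t
  proof -
    have "\<bar>\<eta> s - \<eta> t\<bar> \<le> L * \<bar>(s - a - c * w s) - (t - a - c * w t)\<bar>"
      unfolding \<eta>_def by (rule wL) (use \<eta>T2 that in auto)
    also have "\<dots> \<le> L * (\<bar>s - t\<bar> + \<bar>c\<bar> * (L * \<bar>s - t\<bar>))"
    proof (rule mult_left_mono[OF _ L0])
      have "\<bar>(s - a - c * w s) - (t - a - c * w t)\<bar> \<le> \<bar>s - t\<bar> + \<bar>c\<bar> * \<bar>w s - w t\<bar>"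
        unfolding abs_mult[symmetric] right_diff_distrib by linarith
      also have "\<bar>c\<bar> * \<bar>w s - w t\<bar> \<le> \<bar>c\<bar> * (L * \<bar>s - t\<bar>)"
        using wL[of s t] that T23 by (intro mult_left_mono) auto
      finally show "\<bar>(s - a - c * w s) - (t - a - c * w t)\<bar> \<le> \<bar>s - t\<bar> + \<bar>c\<bar> * (L * \<bar>s - t\<bar>)"
        by simp
    qed
    finally show ?thesis by (simp add: dL algebra_simps)
  qed
  have gLip: "\<bar>g s - g t\<bar> \<le> (\<bar>\<mu>\<bar> * L + \<bar>\<sigma>\<bar> * d) * \<bar>s - t\<bar>" if "T3 \<le> s" "T3 \<le> t" for s t
  proof -
    have "g s - g t = \<mu> * (w s - w t) + \<sigma> * (\<eta> s - \<eta> t)" by (simp add: g_def algebra_simps)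
    then have "\<bar>g s - g t\<bar> \<le> \<bar>\<mu>\<bar> * \<bar>w s - w t\<bar> + \<bar>\<sigma>\<bar> * \<bar>\<eta> s - \<eta> t\<bar>"
      using abs_triangle_ineq[of "\<mu> * (w s - w t)" "\<sigma> * (\<eta> s - \<eta> t)"] by (simp add: abs_mult)
    also have "\<dots> \<le> \<bar>\<mu>\<bar> * (L * \<bar>s - t\<bar>) + \<bar>\<sigma>\<bar> * (d * \<bar>s - t\<bar>)"
      using wL[of s t] \<eta>L[OF that] that T23 by (intro add_mono mult_left_mono) auto
    finally show ?thesis by (simp add: algebra_simps)
  qed
  \<comment> \<open>The margin \<open>R + 1\<close> keeps both the delay interval and the \<open>\<delta>\<close>-neighbourhood of \<open>t\<close> beyond \<open>T3\<close>.\<close>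
  obtain t where t: "n - \<delta>\<^sup>2 < w t" "T3 + R + 1 \<le> t"
  proof -
    have "\<exists>\<^sub>F t in at_top. n - \<delta>\<^sup>2 < w t \<and> T3 + R + 1 \<le> t"
      using frequently_eventually_frequently[OF freq eventually_ge_at_top] .
    then show ?thesis using that by (auto dest: frequently_ex)
  qed
  define r where "r = a + c * w t"
  have tT: "T3 + 1 \<le> t" "T \<le> t" "T1 \<le> t" using t \<open>0 \<le> R\<close> T23 by auto
  have r: "0 \<le> r" "r \<le> R" unfolding r_def using delay[of t] tT by auto
  have \<eta>r: "\<eta> t = w (t - r)" unfolding \<eta>_def r_def by (simp add: algebra_simps)
  have "\<bar>g t\<bar> \<le> (1 + (\<bar>\<mu>\<bar> * L + \<bar>\<sigma>\<bar> * d)) * \<delta>"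
  proof (rule derivative_small_near_supremum[where w = w and g = g and t = t and n = n])
    fix s assume "\<bar>s - t\<bar> \<le> \<delta>"
    then have "T3 \<le> s" using tT \<delta> by linarith
    then show "(w has_real_derivative g s) (at s)"
      "\<bar>g s - g t\<bar> \<le> (\<bar>\<mu>\<bar> * L + \<bar>\<sigma>\<bar> * d) * \<bar>s - t\<bar>"
      using derg gLip tT T23 by auto
  qed (use \<delta> L0 d0 t tT T23 T1(2)[of "t - \<delta>"] T1(2)[of "t + \<delta>"] in auto)
  moreover have "defect \<mu> \<sigma> k r (w t) (w (t - r)) m d \<le> 0"
  proof (rule defect_nonpos[where w = w and \<eta> = \<eta>])
    fix s assume s: "t - r \<le> s" "s \<le> t"
    then have "T3 \<le> s" using t r by linarith
    show "(w has_real_derivative \<mu> * w s + \<sigma> * \<eta> s) (at s)"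
      using derg[of s] \<open>T3 \<le> s\<close> T23 by (simp add: g_def)
    have "m \<le> \<eta> s" using T1(2)[OF \<eta>T1, of s] \<open>T3 \<le> s\<close> T23 by (simp add: \<eta>_def)
    moreover have "\<eta> t + d * (s - t) \<le> \<eta> s" using \<eta>L[of s t] s tT \<open>T3 \<le> s\<close> by (simp add: algebra_simps)
    ultimately show "envelope k m (w (t - r)) d (s - t) \<le> \<eta> s" by (simp add: envelope_def \<eta>r)
  qed (use assms r in auto)
  ultimately show thesis
    using that[of "w t" "w (t - r)"] t(1) T1(2)[OF \<open>T1 \<le> t\<close>] T1(2)[of "t - r"] r \<eta>T1[of t] tT T23
    by (simp add: g_def \<eta>r r_def algebra_simps)
qed

text \<open>
  Here \<open>M\<close> is any asymptotic lower bound and \<open>N\<close> is the upper limit. The first two claims come from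
  the limit \<open>-\<mu> N / \<sigma>\<close> of the delayed values, which lies between \<open>M\<close> and \<open>N\<close>. The sign of \<open>c\<close> is
  arbitrary, so that the lemma also applies to \<open>-w\<close>.
\<close>

lemma limsup_inequalities:
  fixes w :: "real \<Rightarrow> real"
  assumes \<sigma>: "\<sigma> \<le> \<mu>" "\<mu> < 0"
    and der: "\<And>t. T \<le> t \<Longrightarrow> (w has_real_derivative \<mu> * w t + \<sigma> * w (t - a - c * w t)) (at t)"
    and delay: "\<And>t. T \<le> t \<Longrightarrow> 0 \<le> a + c * w t" "\<And>t. T \<le> t \<Longrightarrow> a + c * w t \<le> R"
    and M: "\<And>e. e > 0 \<Longrightarrow> \<forall>\<^sub>F t in at_top. M - e < w t"
    and N: "\<And>e. e > 0 \<Longrightarrow> \<forall>\<^sub>F t in at_top. w t < N + e"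
    and freq: "\<And>e. e > 0 \<Longrightarrow> \<exists>\<^sub>F t in at_top. N - e < w t"
  shows "0 \<le> N" "M \<le> - (\<mu> / \<sigma>) * N" "0 \<le> a + c * N"
    "defect \<mu> \<sigma> k (a + c * N) N (- (\<mu> / \<sigma>) * N) M (D \<mu> \<sigma> \<bar>c\<bar> M N) \<le> 0"
proof -
  define \<delta> where "\<delta> j = inverse (real (Suc j))" for j
  \<comment> \<open>With this \<open>e\<close>, a value above \<open>N - e\<close> is within \<open>\<delta>\<^sup>2\<close> of the eventual upper bound \<open>N + e\<close>.\<close>
  define e where "e j = (\<delta> j)\<^sup>2 / 2" for j
  define m where "m j = M - e j" for j
  define n where "n j = N + e j" for j
  define L where "L j = (\<bar>\<mu>\<bar> + \<bar>\<sigma>\<bar>) * max \<bar>m j\<bar> \<bar>n j\<bar>" for j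
  define d where "d j = D \<mu> \<sigma> \<bar>c\<bar> (m j) (n j)" for j
  have \<delta>: "0 < \<delta> j" "\<delta> j \<le> 1" and e: "0 < e j" for j
    by (auto simp: \<delta>_def e_def field_simps)
  have "\<exists>v h. n j - (\<delta> j)\<^sup>2 < v \<and> v < n j \<and> m j < h \<and> h < n j \<and> 0 \<le> a + c * v \<and>
    \<bar>\<mu> * v + \<sigma> * h\<bar> \<le> (1 + (\<bar>\<mu>\<bar> * L j + \<bar>\<sigma>\<bar> * d j)) * \<delta> j \<and>
    defect \<mu> \<sigma> k (a + c * v) v h (m j) (d j) \<le> 0" for j
  proof -
    have fr: "\<exists>\<^sub>F t in at_top. n j - (\<delta> j)\<^sup>2 < w t"
      using freq[OF e[of j]] by (simp add: n_def e_def field_simps)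
    have lo: "\<forall>\<^sub>F t in at_top. m j < w t" and up: "\<forall>\<^sub>F t in at_top. w t < n j"
      using M[OF e[of j]] N[OF e[of j]] by (simp_all add: m_def n_def)
    have "\<sigma> \<le> 0" using \<sigma> by simp
    show ?thesis
      by (rule near_sup_point[where k = k, OF \<open>\<sigma> \<le> 0\<close> der delay lo up fr \<delta> L_def d_def])
        (assumption | blast)+
  qed
  then obtain v h where v: "\<And>j. n j - (\<delta> j)\<^sup>2 < v j" "\<And>j. v j < n j" and h: "\<And>j. m j < h j" "\<And>j. h j < n j"
    and r: "\<And>j. 0 \<le> a + c * v j"
    and g: "\<And>j. \<bar>\<mu> * v j + \<sigma> * h j\<bar> \<le> (1 + (\<bar>\<mu>\<bar> * L j + \<bar>\<sigma>\<bar> * d j)) * \<delta> j"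
    and Q: "\<And>j. defect \<mu> \<sigma> k (a + c * v j) (v j) (h j) (m j) (d j) \<le> 0" by metis
  have lim_\<delta>: "\<delta> \<longlonglongrightarrow> 0" unfolding \<delta>_def by (rule LIMSEQ_inverse_real_of_nat)
  have "e \<longlonglongrightarrow> 0\<^sup>2 / 2" unfolding e_def by (intro tendsto_intros lim_\<delta>) simp
  then have lim_e: "e \<longlonglongrightarrow> 0" by simp
  have "m \<longlonglongrightarrow> M - 0" "n \<longlonglongrightarrow> N + 0" unfolding m_def n_def by (intro tendsto_intros lim_e)+
  then have lim_m: "m \<longlonglongrightarrow> M" and lim_n: "n \<longlonglongrightarrow> N" by simp_all
  have "(\<lambda>j. n j - (\<delta> j)\<^sup>2) \<longlonglongrightarrow> N - 0\<^sup>2" by (intro tendsto_intros lim_\<delta> lim_n)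
  then have lim_low: "(\<lambda>j. n j - (\<delta> j)\<^sup>2) \<longlonglongrightarrow> N" by simp
  have lim_v: "v \<longlonglongrightarrow> N"
    by (rule tendsto_sandwich[OF _ _ lim_low lim_n]) (simp_all add: v less_imp_le)
  have lim_d: "d \<longlonglongrightarrow> D \<mu> \<sigma> \<bar>c\<bar> M N"
    unfolding d_def by (rule tendsto_D[OF lim_m lim_n])
  have "(\<lambda>j. max \<bar>m j\<bar> \<bar>n j\<bar>) \<longlonglongrightarrow> max \<bar>M\<bar> \<bar>N\<bar>"
    by (rule tendsto_max tendsto_rabs lim_m lim_n)+
  then have lim_L: "L \<longlonglongrightarrow> (\<bar>\<mu>\<bar> + \<bar>\<sigma>\<bar>) * max \<bar>M\<bar> \<bar>N\<bar>"
    unfolding L_def by (rule tendsto_mult_left)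
  have "(\<lambda>j. (1 + (\<bar>\<mu>\<bar> * L j + \<bar>\<sigma>\<bar> * d j)) * \<delta> j) \<longlonglongrightarrow>
     (1 + (\<bar>\<mu>\<bar> * ((\<bar>\<mu>\<bar> + \<bar>\<sigma>\<bar>) * max \<bar>M\<bar> \<bar>N\<bar>) + \<bar>\<sigma>\<bar> * D \<mu> \<sigma> \<bar>c\<bar> M N)) * 0"
    by (intro tendsto_mult[OF _ lim_\<delta>] tendsto_add[OF tendsto_const] tendsto_add[OF tendsto_mult_left[OF lim_L]] tendsto_mult_left[OF lim_d])
  then have bound: "(\<lambda>j. (1 + (\<bar>\<mu>\<bar> * L j + \<bar>\<sigma>\<bar> * d j)) * \<delta> j) \<longlonglongrightarrow> 0" by simp
  have lim_g: "(\<lambda>j. \<mu> * v j + \<sigma> * h j) \<longlonglongrightarrow> 0"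
    by (rule Lim_null_comparison[OF _ bound]) (simp add: g)
  have "(\<lambda>j. ((\<mu> * v j + \<sigma> * h j) - \<mu> * v j) / \<sigma>) \<longlonglongrightarrow> (0 - \<mu> * N) / \<sigma>"
    by (intro tendsto_intros lim_g lim_v) (use \<sigma> in auto)
  then have lim_h: "h \<longlonglongrightarrow> - (\<mu> / \<sigma>) * N" using \<sigma> by (simp add: field_simps)
  show "M \<le> - (\<mu> / \<sigma>) * N"
    by (rule LIMSEQ_le[OF lim_m lim_h]) (use h in \<open>auto intro: less_imp_le\<close>)
  have "- (\<mu> / \<sigma>) * N \<le> N"
    by (rule LIMSEQ_le[OF lim_h lim_n]) (use h in \<open>auto intro: less_imp_le\<close>)
  then have "0 \<le> N * (1 + \<mu> / \<sigma>)" by (simp add: algebra_simps)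
  moreover have "0 < \<mu> / \<sigma>" using \<sigma> by (simp add: divide_neg_neg)
  ultimately show "0 \<le> N" by (simp add: zero_le_mult_iff)
  have lim_r: "(\<lambda>j. a + c * v j) \<longlonglongrightarrow> a + c * N" by (intro tendsto_intros lim_v)
  show "0 \<le> a + c * N"
    by (rule LIMSEQ_le_const[OF lim_r]) (use r in auto)
  show "defect \<mu> \<sigma> k (a + c * N) N (- (\<mu> / \<sigma>) * N) M (D \<mu> \<sigma> \<bar>c\<bar> M N) \<le> 0"
    by (rule LIMSEQ_le_const2[OF tendsto_defect[OF lim_r lim_v lim_h lim_m lim_d]]) (use Q in auto)
qed

section \<open>From inequalities to equations\<close>

text \<open>
  \<open>F M N\<close> is \<open>J (N, M, N)\<close> and \<open>G M N\<close> is \<open>-J (M, N, M)\<close>. Enlarging \<open>N\<close> lowers \<open>G\<close>, and lowering \<open>M\<close>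
  lowers \<open>F\<close>, because the bounds on the delayed values weaken. Hence the pair can be enlarged
  until both inequalities are equations.
\<close>

lemma no_nonzero_subsolution:
  assumes "a > 0" "c > 0" "\<sigma> \<le> \<mu>" "\<mu> < 0"
    and F: "F = (\<lambda>M N. defect \<mu> \<sigma> k (a + c * N) N (- (\<mu> / \<sigma>) * N) M (D \<mu> \<sigma> c M N))"
    and G: "G = (\<lambda>M N. defect \<mu> \<sigma> k (a + c * M) (- M) (- (\<mu> / \<sigma>) * - M) (- N) (D \<mu> \<sigma> c M N))"
    and M0: "M0 = - (a / c)" and N0: "N0 = a * \<sigma> / (c * \<mu>)"
    and unique: "\<And>M N. M \<in> {M0..0} \<Longrightarrow> N \<in> {0..N0} \<Longrightarrow> F M N = 0 \<Longrightarrow> G M N = 0 \<Longrightarrow> M = 0 \<and> N = 0"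
    and MN: "M \<in> {M0..0}" "N \<in> {0..N0}" "F M N \<le> 0" "G M N \<le> 0"
  shows "M = 0 \<and> N = 0"
proof -
  have q: "0 < \<mu> / \<sigma>" "\<mu> / \<sigma> \<le> 1" using assms(3,4) by (auto simp: divide_neg_neg)
  have "\<sigma> < 0" using assms by simp
  have M0': "M0 < 0" "a + c * M0 = 0" "(\<mu> / \<sigma>) * N0 = - M0"
    using \<open>a > 0\<close> \<open>c > 0\<close> \<open>\<mu> < 0\<close> \<open>\<sigma> < 0\<close> unfolding M0 N0 by simp_all
  have delay: "0 \<le> a + c * x" if "M0 \<le> x" for x
    using mult_left_mono[OF that, of c] M0'(2) \<open>c > 0\<close> by linarith
  have F_tendsto: "((\<lambda>p. F (m p) (n p)) \<longlongrightarrow> F m0 n0) A" if "(m \<longlongrightarrow> m0) A" "(n \<longlongrightarrow> n0) A" for m n m0 n0 and A :: "'z filter"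
    unfolding F by (intro tendsto_defect tendsto_D tendsto_add tendsto_mult tendsto_minus tendsto_const that)
  have G_tendsto: "((\<lambda>p. G (m p) (n p)) \<longlongrightarrow> G m0 n0) A" if "(m \<longlongrightarrow> m0) A" "(n \<longlongrightarrow> n0) A" for m n m0 n0 and A :: "'z filter"
    unfolding G by (intro tendsto_defect tendsto_D tendsto_add tendsto_mult tendsto_minus tendsto_const that)
  have F_mono: "F M' N \<le> F M N" if "M' \<le> M" "M \<le> 0" "M0 \<le> N" for M M' N
    unfolding F using that \<open>c > 0\<close> \<open>\<sigma> < 0\<close> delay by (intro defect_mono D_mono) auto
  have G_mono: "G M N' \<le> G M N" if "N \<le> N'" "0 \<le> N" "M0 \<le> M" for M N N'
    unfolding G using that \<open>c > 0\<close> \<open>\<sigma> < 0\<close> delay by (intro defect_mono D_mono) auto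
  \<comment> \<open>On the sides \<open>N = N0\<close> and \<open>M = M0\<close> of the rectangle one inequality fails, so the enlargement is
     never stopped by the boundary. At \<open>N0\<close> the delayed value \<open>-\<mu> N0 / \<sigma>\<close> is \<open>M0\<close>; at \<open>M0\<close> the delay is
     zero.\<close>
  have F_N0: "0 < F M N0" if "M0 \<le> M" for M
  proof -
    have "M0 \<le> N0" using M0' q by (smt (verit) mult_nonneg_nonpos)
    define E where "E = exp (\<mu> * (a + c * N0))"
    have "E \<le> 1" "0 < E" unfolding E_def using delay[OF \<open>M0 \<le> N0\<close>] \<open>\<mu> < 0\<close> by (auto simp: mult_nonpos_nonneg)
    then have E: "0 \<le> (E - 1) / \<mu>" using \<open>\<mu> < 0\<close> by (simp add: divide_nonpos_neg)
    have "N0 > 0" using assms by (simp add: zero_less_divide_iff mult_neg_neg mult_pos_neg)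
    have "\<sigma> * M * ((E - 1) / \<mu>) \<le> \<sigma> * M0 * ((E - 1) / \<mu>)"
      by (intro mult_right_mono mult_left_mono_neg) (use that E \<open>\<sigma> < 0\<close> in auto)
    also have "\<sigma> * M0 * ((E - 1) / \<mu>) = N0 * (1 - E)"
    proof -
      have "\<sigma> * M0 = - (\<mu> * N0)" using \<open>c > 0\<close> \<open>\<mu> < 0\<close> unfolding M0 N0 by simp
      then show ?thesis using \<open>\<mu> < 0\<close> by (simp add: field_simps)
    qed
    finally have "N0 - M0 * E - \<sigma> * M * ((E - 1) / \<mu>) \<ge> (N0 - M0) * E" by (simp add: algebra_simps)
    moreover have "(N0 - M0) * E > 0" using \<open>N0 > 0\<close> M0' \<open>0 < E\<close> by (intro mult_pos_pos) auto
    moreover have "N0 - M0 * E - \<sigma> * M * ((E - 1) / \<mu>) \<le> F M N0"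
      using defect_ge[of \<mu> \<sigma> "a + c * N0" N0 M0 M k] delay[OF \<open>M0 \<le> N0\<close>] assms(4) \<open>\<sigma> < 0\<close> M0'
      unfolding F E_def by simp
    ultimately show ?thesis by linarith
  qed
  have G_M0: "0 < G M0 N" for N
  proof -
    have "G M0 N = - M0 * (1 + \<mu> / \<sigma>)" unfolding G defect_def M0'(2) by (simp add: algebra_simps)
    moreover have "M0 * (1 + \<mu> / \<sigma>) < 0" using M0' q by (intro mult_neg_pos) auto
    ultimately show ?thesis by simp
  qed
  define S where "S = {p \<in> {M0..0} \<times> {0..N0}. F (fst p) (snd p) \<le> 0 \<and> G (fst p) (snd p) \<le> 0}"
  have "compact S"
  proof -
    have "((\<lambda>p. F (fst p) (snd p)) \<longlongrightarrow> F (fst p) (snd p)) (at p)"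
      "((\<lambda>p. G (fst p) (snd p)) \<longlongrightarrow> G (fst p) (snd p)) (at p)" for p
      by (rule F_tendsto G_tendsto tendsto_fst tendsto_snd tendsto_ident_at)+
    then have "continuous_on UNIV (\<lambda>p. F (fst p) (snd p))" "continuous_on UNIV (\<lambda>p. G (fst p) (snd p))"
      unfolding continuous_on_def by blast+
    then have "closed {p. F (fst p) (snd p) \<le> 0 \<and> G (fst p) (snd p) \<le> 0}"
      by (intro closed_Collect_conj closed_Collect_le) auto
    then have "compact (({M0..0} \<times> {0..N0}) \<inter> {p. F (fst p) (snd p) \<le> 0 \<and> G (fst p) (snd p) \<le> 0})"
      by (intro compact_Int_closed compact_Times) auto
    moreover have "S = ({M0..0} \<times> {0..N0}) \<inter> {p. F (fst p) (snd p) \<le> 0 \<and> G (fst p) (snd p) \<le> 0}"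
      unfolding S_def by blast
    ultimately show ?thesis by simp
  qed
  moreover have "(M, N) \<in> S" using MN by (simp add: S_def)
  moreover have "continuous_on S (\<lambda>p. snd p - fst p)"
    by (rule continuous_on_diff continuous_on_fst continuous_on_snd continuous_on_id)+
  ultimately have "\<exists>p\<in>S. \<forall>p'\<in>S. snd p' - fst p' \<le> snd p - fst p"
    using continuous_attains_sup[of S "\<lambda>p. snd p - fst p"] by blast
  then obtain m n where mn: "(m, n) \<in> S" and max: "\<And>m' n'. (m', n') \<in> S \<Longrightarrow> n' - m' \<le> n - m"
    by fastforce
  have bounds: "M0 \<le> m" "m \<le> 0" "0 \<le> n" "n \<le> N0" and le: "F m n \<le> 0" "G m n \<le> 0"
    using mn by (auto simp: S_def)
  have "F m n = 0"
  proof (rule ccontr)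
    assume "F m n \<noteq> 0"
    then have neg: "F m n < 0" using le by simp
    have "n < N0" using F_N0[of m] bounds le by (cases "n = N0") auto
    have "((\<lambda>x. F m x) \<longlongrightarrow> F m n) (at_right n)" by (rule F_tendsto[OF tendsto_const tendsto_ident_at])
    then have "\<forall>\<^sub>F x in at_right n. F m x < 0" using neg by (rule order_tendstoD)
    moreover have "\<forall>\<^sub>F x in at_right n. n < x \<and> x < N0"
      using \<open>n < N0\<close> by (auto simp: eventually_at_right_field)
    ultimately have "\<forall>\<^sub>F x in at_right n. F m x < 0 \<and> n < x \<and> x < N0" by eventually_elim simp
    then obtain n' where "F m n' < 0" "n < n'" "n' < N0"
      using eventually_happens'[OF trivial_limit_at_right_real] by blast
    then show False using max[of m n'] G_mono[of n n' m] bounds le by (auto simp: S_def)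
  qed
  moreover have "G m n = 0"
  proof (rule ccontr)
    assume "G m n \<noteq> 0"
    then have neg: "G m n < 0" using le by simp
    have "M0 < m" using G_M0[of n] bounds le by (cases "m = M0") auto
    have "((\<lambda>x. G x n) \<longlongrightarrow> G m n) (at_left m)" by (rule G_tendsto[OF tendsto_ident_at tendsto_const])
    then have "\<forall>\<^sub>F x in at_left m. G x n < 0" using neg by (rule order_tendstoD)
    moreover have "\<forall>\<^sub>F x in at_left m. x < m \<and> M0 < x"
      using \<open>M0 < m\<close> by (auto simp: eventually_at_left_field)
    ultimately have "\<forall>\<^sub>F x in at_left m. G x n < 0 \<and> x < m \<and> M0 < x" by eventually_elim simp
    then obtain m' where "G m' n < 0" "m' < m" "M0 < m'"
      using eventually_happens'[OF trivial_limit_at_left_real] by blast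
    then show False using max[of m' n] F_mono[of m' m n] bounds le M0' by (auto simp: S_def)
  qed
  ultimately have "m = 0 \<and> n = 0" using unique bounds by simp
  then show ?thesis using max[OF \<open>(M, N) \<in> S\<close>] MN by auto
qed

section \<open>A priori bounds\<close>

text \<open>
  Lower bound: where \<open>u = M0\<close> the delay vanishes, so the derivative is \<open>(\<mu> + \<sigma>) M0 > 0\<close>. Upper bound:
  above \<open>N0\<close>, delayed values of at least \<open>M0\<close> make the derivative nonpositive. The initial function
  is controlled on \<open>[-\<tau>, 0]\<close> only, and for \<open>u > max (\<phi> 0) N0\<close> the delay exceeds \<open>\<tau>\<close>. But where \<open>u\<close>
  last equals that bound its derivative is nonpositive, so the delayed argument
  \<open>t - a - c u t\<close> increases there and does not fall below \<open>-\<tau>\<close> immediately afterwards.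
\<close>

lemma sdde_bounds:
  assumes "a > 0" and "c > 0" and "\<sigma> \<le> \<mu>" and "\<mu> < 0"
    and M0: "M0 = - (a / c)" and N0: "N0 = a * \<sigma> / (c * \<mu>)"
    and \<tau>: "\<tau> = a + c * max (\<phi> 0) N0"
    and \<phi>_cont: "\<forall>t\<in>{-\<tau>..0}. continuous (at t within {..0}) \<phi>"
    and \<phi>_ge: "\<forall>t\<in>{-\<tau>..0}. \<phi> t \<ge> M0"
    and sol: "sdde_solution \<mu> \<sigma> a c \<phi> u"
    and "0 \<le> t"
  shows "M0 \<le> u t \<and> u t \<le> max (\<phi> 0) N0"
proof -
  define U where "U = max (\<phi> 0) N0"
  define g where "g t = t - a - c * u t" for t
  define rhs where "rhs t = \<mu> * u t + \<sigma> * u (g t)" for t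
  have "\<sigma> < 0" using assms by simp
  have "N0 > 0" unfolding N0 using assms(1,2,4) \<open>\<sigma> < 0\<close> by (simp add: zero_less_divide_iff mult_neg_neg mult_pos_neg)
  have "M0 < 0" "a + c * M0 = 0" unfolding M0 using assms(1,2) by simp_all
  have \<sigma>M0: "\<sigma> * M0 = - (\<mu> * N0)" using \<open>c > 0\<close> \<open>\<mu> < 0\<close> unfolding M0 N0 by simp
  have "U \<ge> N0" "U \<ge> \<phi> 0" by (auto simp: U_def)
  have \<tau>U: "\<tau> = a + c * U" by (simp add: \<tau> U_def)
  then have "\<tau> > 0" using \<open>U \<ge> N0\<close> \<open>N0 > 0\<close> assms(1,2) by (simp add: add_pos_pos)
  have u\<phi>: "u t = \<phi> t" if "t \<le> 0" for t using sol that by (simp add: sdde_solution_def)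
  have ode_pos: "(u has_real_derivative rhs t) (at t)" if "t > 0" for t
    using sol that by (simp add: sdde_solution_def rhs_def g_def)
  obtain u' where u'_cont: "continuous_on {0..} u'"
    and u': "\<And>t. 0 \<le> t \<Longrightarrow> (u has_real_derivative u' t) (at t within {0..})"
    using sol unfolding sdde_solution_def by blast
  have u_cont: "continuous_on {0..} u"
    by (rule DERIV_continuous_on) (use u' in auto)
  have u_isCont: "isCont u p" if p: "p \<in> {-\<tau>..0}" for p
  proof -
    have "continuous (at p within {..0}) \<phi>" using \<phi>_cont p by blast
    then have left: "continuous (at p within {..0}) u"
      by (rule continuous_transform_within[of _ _ _ 1]) (use p u\<phi> in auto)
    show ?thesis
    proof (cases "p = 0")
      case True
      have "continuous (at 0 within {0..}) u" using u_cont by (simp add: continuous_on_eq_continuous_within)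
      then have "(u \<longlongrightarrow> u 0) (at 0 within {..0} \<union> {0..})"
        using left True by (intro Lim_Un) (simp_all add: continuous_within)
      moreover have "{..0} \<union> {0..} = (UNIV :: real set)" by auto
      ultimately show ?thesis using True by (simp add: isCont_def)
    next
      case False
      then have "p \<in> interior {..0}" using p by simp
      then show ?thesis using left at_within_interior by metis
    qed
  qed
  have u0: "M0 \<le> u 0" "u 0 \<le> U" using u\<phi>[of 0] \<phi>_ge \<open>\<tau> > 0\<close> \<open>U \<ge> \<phi> 0\<close> by auto
  have gle: "g t \<le> t" if "M0 \<le> u t" for t
    using mult_left_mono[OF that, of c] \<open>c > 0\<close> \<open>a + c * M0 = 0\<close> unfolding g_def by linarith
  have gge: "t - \<tau> \<le> g t" if "u t \<le> U" for t
    using mult_left_mono[OF that, of c] \<open>c > 0\<close> unfolding g_def \<tau>U by linarith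
  \<comment> \<open>The equation extends to \<open>t = 0\<close> with a one-sided derivative, so that a solution starting on one of
     the bounds needs no separate treatment.\<close>
  have ode: "(u has_real_derivative rhs t) (at t within {0..})" if "0 \<le> t" for t
  proof (cases "t = 0")
    case False
    then show ?thesis using ode_pos[of t] that by (auto intro: has_field_derivative_at_within)
  next
    case True
    have u_lim: "(u \<longlongrightarrow> u 0) (at_right 0)"
      using u_cont by (auto simp: continuous_on_def intro: tendsto_within_subset)
    have "(g \<longlongrightarrow> g 0) (at_right 0)"
      unfolding g_def by (intro tendsto_diff tendsto_mult_left tendsto_const tendsto_ident_at u_lim)
    moreover have "isCont u (g 0)"
      using gle[OF u0(1)] gge[OF u0(2)] by (intro u_isCont) simp
    ultimately have "((\<lambda>t. u (g t)) \<longlongrightarrow> u (g 0)) (at_right 0)"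
      by (rule isCont_tendsto_compose[rotated])
    then have "(rhs \<longlongrightarrow> rhs 0) (at_right 0)"
      unfolding rhs_def by (intro tendsto_add tendsto_mult_left u_lim)
    moreover have "\<forall>\<^sub>F t in at_right 0. u' t = rhs t"
    proof -
      have "u' t = rhs t" if "0 < t" for t
      proof -
        have "at t within {0..} = at t" using that by (intro at_within_interior) simp
        then show ?thesis using u'[of t] ode_pos[OF that] that by (auto intro: DERIV_unique)
      qed
      then show ?thesis by (auto simp: eventually_at_filter)
    qed
    ultimately have "(u' \<longlongrightarrow> rhs 0) (at_right 0)"
      using tendsto_cong by blast
    moreover have "(u' \<longlongrightarrow> u' 0) (at_right 0)"
      using u'_cont by (auto simp: continuous_on_def intro: tendsto_within_subset)
    ultimately have "u' 0 = rhs 0" by (intro tendsto_unique[of "at_right 0"]) auto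
    then show ?thesis using u'[of 0] True by simp
  qed
  have lower: "M0 \<le> u t" if "0 \<le> t" for t
  proof (rule ccontr)
    assume "\<not> M0 \<le> u t"
    with that u0 obtain t0 where t0: "0 \<le> t0" "t0 < t" "- u t0 = - M0" "\<And>s. t0 < s \<Longrightarrow> s \<le> t \<Longrightarrow> - M0 < - u s"
      using last_crossing[of "\<lambda>t. - u t" "- M0" t] u_cont by (auto intro: continuous_on_minus)
    have "g t0 = t0" using t0(3) \<open>a + c * M0 = 0\<close> by (simp add: g_def algebra_simps)
    then have "rhs t0 = (\<mu> + \<sigma>) * M0" using t0(3) by (simp add: rhs_def algebra_simps)
    then have "rhs t0 > 0" using \<open>M0 < 0\<close> \<open>\<mu> < 0\<close> \<open>\<sigma> < 0\<close> by (simp add: mult_neg_neg)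
    then obtain d where d: "d > 0" "\<And>h. 0 < h \<Longrightarrow> t0 + h \<in> {0..} \<Longrightarrow> h < d \<Longrightarrow> u t0 < u (t0 + h)"
      using has_real_derivative_pos_inc_right[OF ode[OF t0(1)]] by blast
    define h where "h = min d (t - t0) / 2"
    have "0 < h" "h < d" "t0 + h \<le> t" using d(1) t0(2) by (auto simp: h_def min_def field_simps)
    then show False using d(2)[of h] t0(4)[of "t0 + h"] t0(1,3) by auto
  qed
  have u_ge: "M0 \<le> u t" if "- \<tau> \<le> t" for t
    using lower[of t] u\<phi>[of t] \<phi>_ge that by (cases "0 \<le> t") auto
  have rhs_le: "rhs t \<le> 0" if "U \<le> u t" "- \<tau> \<le> g t" for t
  proof -
    have "\<sigma> * u (g t) \<le> \<sigma> * M0" using u_ge[OF that(2)] \<open>\<sigma> < 0\<close> by simp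
    moreover have "\<mu> * u t \<le> \<mu> * N0" using that(1) \<open>U \<ge> N0\<close> \<open>\<mu> < 0\<close> by simp
    ultimately show ?thesis unfolding rhs_def using \<sigma>M0 by linarith
  qed
  have "u t \<le> U" if "0 \<le> t" for t
  proof (rule ccontr)
    assume "\<not> u t \<le> U"
    with that u0 obtain t0 where t0: "0 \<le> t0" "t0 < t" "u t0 = U" "\<And>s. t0 < s \<Longrightarrow> s \<le> t \<Longrightarrow> U < u s"
      using last_crossing[of u U t] u_cont by auto
    have "- \<tau> \<le> g t0" using gge[of t0] t0 by simp
    have "rhs t0 \<le> 0" using rhs_le t0(3) \<open>- \<tau> \<le> g t0\<close> by simp
    then have "0 < 1 - c * rhs t0" using \<open>c > 0\<close> mult_nonneg_nonpos[of c "rhs t0"] by simp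
    moreover have "(g has_real_derivative 1 - c * rhs t0) (at t0 within {0..})"
      unfolding g_def using ode[OF t0(1)] by (auto intro!: derivative_eq_intros)
    ultimately obtain d where d: "d > 0" "\<And>h. 0 < h \<Longrightarrow> t0 + h \<in> {0..} \<Longrightarrow> h < d \<Longrightarrow> g t0 < g (t0 + h)"
      using has_real_derivative_pos_inc_right by blast
    define h where "h = min d (t - t0) / 2"
    have h: "0 < h" "h < d" "t0 + h \<le> t" using d(1) t0(2) by (auto simp: h_def min_def field_simps)
    have "u (t0 + h) \<le> u t0"
    proof (rule DERIV_nonpos_imp_decreasing_open[where f = u and a = t0 and b = "t0 + h"])
      fix x assume x: "t0 < x" "x < t0 + h"
      have "- \<tau> \<le> g x" using d(2)[of "x - t0"] x h t0(1) \<open>- \<tau> \<le> g t0\<close> by simp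
      then have "rhs x \<le> 0" using rhs_le t0(4)[of x] x h by simp
      then show "\<exists>y. (u has_real_derivative y) (at x) \<and> y \<le> 0"
        using ode_pos[of x] x t0(1) by auto
    next
      show "continuous_on {t0..t0 + h} u"
        by (rule continuous_on_subset[OF u_cont]) (use t0(1) in auto)
    qed (use h in simp)
    then show False using t0(3) t0(4)[of "t0 + h"] h by simp
  qed
  then show ?thesis using lower \<open>0 \<le> t\<close> by (simp add: U_def)
qed

section \<open>Convergence to zero\<close>

theorem theorem3p7:
  fixes k :: nat and a c \<mu> \<sigma> M0 N0 \<tau> :: real and \<phi> u :: "real \<Rightarrow> real"
  assumes "k = 1 \<or> k = 2"
    and "a > 0" and "c > 0" and "\<sigma> \<le> \<mu>" and "\<mu> < 0"
    and "M0 = - (a / c)" and "N0 = a * \<sigma> / (c * \<mu>)"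
    and "\<tau> = a + c * max (\<phi> 0) N0"
    and "\<forall>t\<in>{-\<tau>..0}. continuous (at t within {..0}) \<phi>"
    and "\<forall>t\<in>{-\<tau>..0}. \<phi> t \<ge> M0"
    and "{(M, N). M \<in> {M0..0} \<and> N \<in> {0..N0} \<and>
            J \<mu> \<sigma> a c k N M N = 0 \<and> J \<mu> \<sigma> a c k M N M = 0} = {(0, 0)}"
    and "sdde_solution \<mu> \<sigma> a c \<phi> u"
  shows "(u \<longlongrightarrow> 0) at_top"
proof -
  define U where "U = max (\<phi> 0) N0"
  have u: "M0 \<le> u t" "u t \<le> U" if "0 \<le> t" for t
    using sdde_bounds[OF assms(2-10,12) that] by (auto simp: U_def)
  have "\<sigma> < 0" using assms by simp
  have cM0: "c * M0 = - a" using assms(3,6) by simp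
  have delay: "0 \<le> a + c * x" if "M0 \<le> x" for x
    using mult_left_mono[OF that, of c] \<open>c > 0\<close> cM0 by simp
  have ode: "(u has_real_derivative \<mu> * u t + \<sigma> * u (t - a - c * u t)) (at t)" if "1 \<le> t" for t
    using assms(12) that by (simp add: sdde_solution_def)
  have delay_u: "0 \<le> a + c * u t" "a + c * u t \<le> a + c * U" if "1 \<le> t" for t
    using u[of t] that delay \<open>c > 0\<close> by auto
  have bdd: "\<forall>\<^sub>F t in at_top. \<bar>u t\<bar> \<le> \<bar>M0\<bar> + \<bar>U\<bar>"
    using eventually_ge_at_top[of 0] by eventually_elim (use u in fastforce)
  obtain N where
    N: "\<And>e. e > 0 \<Longrightarrow> \<forall>\<^sub>F t in at_top. u t < N + e" "\<And>e. e > 0 \<Longrightarrow> \<exists>\<^sub>F t in at_top. N - e < u t"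
    using limsup_exists[OF bdd] by blast
  have "\<forall>\<^sub>F t in at_top. \<bar>- u t\<bar> \<le> \<bar>M0\<bar> + \<bar>U\<bar>" using bdd by simp
  then obtain M' where
    M': "\<And>e. e > 0 \<Longrightarrow> \<forall>\<^sub>F t in at_top. - u t < M' + e" "\<And>e. e > 0 \<Longrightarrow> \<exists>\<^sub>F t in at_top. M' - e < - u t"
    by (rule limsup_exists) blast
  define M where "M = - M'"
  have M: "\<forall>\<^sub>F t in at_top. M - e < u t" if "e > 0" for e
    using M'(1)[OF that] by eventually_elim (simp add: M_def)
  define F where "F = (\<lambda>M N. defect \<mu> \<sigma> k (a + c * N) N (- (\<mu> / \<sigma>) * N) M (D \<mu> \<sigma> c M N))"
  define G where "G = (\<lambda>M N. defect \<mu> \<sigma> k (a + c * M) (- M) (- (\<mu> / \<sigma>) * - M) (- N) (D \<mu> \<sigma> c M N))"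
  have sup: "0 \<le> N" "M \<le> - (\<mu> / \<sigma>) * N" "F M N \<le> 0"
    using limsup_inequalities[OF assms(4,5) ode delay_u M N] \<open>c > 0\<close> by (simp_all add: F_def)
  have inf: "M \<le> 0" "0 \<le> a + c * M" "G M N \<le> 0"
  proof -
    have ode': "((\<lambda>t. - u t) has_real_derivative \<mu> * (- u t) + \<sigma> * - u (t - a - (- c) * - u t)) (at t)" if "1 \<le> t" for t
      using DERIV_minus[OF ode[OF that]] by (simp add: algebra_simps)
    have delay': "0 \<le> a + (- c) * - u t" "a + (- c) * - u t \<le> a + c * U" if "1 \<le> t" for t
      using delay_u[OF that] by simp_all
    have N': "\<forall>\<^sub>F t in at_top. - N - e < - u t" if "e > 0" for e
      using N(1)[OF that] by eventually_elim simp
    note limsup_inequalities[OF assms(4,5) ode' delay' N' M']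
    then have "0 \<le> M'" "0 \<le> a + (- c) * M'"
      "defect \<mu> \<sigma> k (a + (- c) * M') M' (- (\<mu> / \<sigma>) * M') (- N) (D \<mu> \<sigma> \<bar>- c\<bar> (- N) M') \<le> 0"
      by simp_all
    moreover have "D \<mu> \<sigma> \<bar>- c\<bar> (- N) M' = D \<mu> \<sigma> c M N"
      using \<open>c > 0\<close> by (simp add: D_def M_def max.commute)
    ultimately show "M \<le> 0" "0 \<le> a + c * M" "G M N \<le> 0" by (simp_all add: M_def G_def)
  qed
  have "M0 \<le> M" using inf(2) cM0 \<open>c > 0\<close> by (smt (verit) mult_le_cancel_left_pos)
  \<comment> \<open>The limit \<open>-\<mu> N / \<sigma>\<close> of the delayed values is at least \<open>M0 = -\<mu> N0 / \<sigma>\<close>.\<close>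
  then have "M0 \<le> - (\<mu> / \<sigma>) * N" using sup by simp
  then have "- (\<mu> * N) \<le> \<sigma> * M0" using \<open>\<sigma> < 0\<close> by (simp add: field_simps)
  moreover have "\<sigma> * M0 = - (\<mu> * N0)" using \<open>c > 0\<close> \<open>\<mu> < 0\<close> unfolding assms(6,7) by simp
  ultimately have "\<mu> * N0 \<le> \<mu> * N" by linarith
  then have "N \<le> N0" using \<open>\<mu> < 0\<close> by simp
  have "M = 0 \<and> N = 0"
  proof (rule no_nonzero_subsolution[OF assms(2-5) F_def G_def assms(6,7)])
    fix M N assume MN: "M \<in> {M0..0}" "N \<in> {0..N0}" "F M N = 0" "G M N = 0"
    show "M = 0 \<and> N = 0"
    proof (cases "M = N")
      case False
      then have "M < N" using MN by auto
      then have sg: "1 = sgn (N - M)" "- 1 = sgn (M - N)" by auto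
      have "M0 \<le> N" using MN by auto
      have "J \<mu> \<sigma> a c k N M N = 1 * defect \<mu> \<sigma> k (a + c * N) (1 * N) (- (\<mu> / \<sigma>) * (1 * N)) (1 * M) (D \<mu> \<sigma> c M N)"
        by (rule J_eq_defect) (use assms MN False sg \<open>M0 \<le> N\<close> delay in auto)
      moreover have "J \<mu> \<sigma> a c k M N M = - 1 * defect \<mu> \<sigma> k (a + c * M) (- 1 * M) (- (\<mu> / \<sigma>) * (- 1 * M)) (- 1 * N) (D \<mu> \<sigma> c N M)"
        by (rule J_eq_defect) (use assms MN False sg delay in auto)
      moreover have "D \<mu> \<sigma> c N M = D \<mu> \<sigma> c M N" by (simp add: D_def max.commute)
      ultimately have "J \<mu> \<sigma> a c k N M N = 0 \<and> J \<mu> \<sigma> a c k M N M = 0"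
        using MN(3,4) unfolding F_def G_def by simp
      then show ?thesis using assms(11) MN(1,2) by blast
    qed (use MN in auto)
  qed (use \<open>M0 \<le> M\<close> inf sup \<open>N \<le> N0\<close> in auto)
  show ?thesis
  proof (rule tendstoI)
    fix e :: real assume "e > 0"
    show "\<forall>\<^sub>F t in at_top. dist (u t) 0 < e"
      using N(1)[OF \<open>e > 0\<close>] M[OF \<open>e > 0\<close>]
      by eventually_elim (use \<open>M = 0 \<and> N = 0\<close> in \<open>simp add: abs_less_iff\<close>)
  qed
qed

end
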